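(* Let $X$ be a Hausdorff topological space and let $F$ be any totally ordered field. The following statements are equivalent: (1) $X$ is zero-dimensional. (2) $X$ is countably completely $F$-regular (CCFR). (3) $Z_c(X,F)$ is a base for the closed sets in $X$.
   Context: A totally ordered field $F$ carries its order (interval) topology. $C_c(X,F)$ is the ring of all continuous functions $f:X\to F$ whose range $f(X)$ is countable. For $f\in C_c(X,F)$, $Z_c(f)=\{x\in X: f(x)=0\}$, and $Z_c(X,F)=\{Z_c(f): f\in C_c(X,F)\}$. A space is zero-dimensional if it has a base of clopen sets. $X$ is called countably completely $F$-regular (CCFR) if it is Hausdorff and, for every closed set $K$ in $X$ and every point $x\in X\setminus K$, there exists $f\in C_c(X,F)$ with $f(x)=0$ and $f(K)=1$ (i.e. $f$ takes the value $1$ at every point of $K$). A family of closed sets is a base for the closed sets if every closed set is an intersection of members of the family. *)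

theory Defs
  imports "HOL-Analysis.Analysis"
begin

text \<open>
  A space is an abstract topology \<open>X :: 'a topology\<close> on \<open>topspace X\<close>; it may be empty. A totally
  ordered field with its order topology is a type of sort
  \<open>{linordered_field, linorder_topology}\<close>: the second class says that the open sets are generated
  by the open rays. Functions on \<open>X\<close> are total HOL functions, and only their values on
  \<open>topspace X\<close> matter.
\<close>

definition zero_dimensional_space :: "'a topology \<Rightarrow> bool" where
  "zero_dimensional_space X \<longleftrightarrow>
     (\<exists>\<B>. (\<forall>B\<in>\<B>. openin X B \<and> closedin X B) \<and>
          openin X = arbitrary union_of (\<lambda>B. B \<in> \<B>))"

definition C_c :: "'a topology \<Rightarrow> ('a \<Rightarrow> 'f::{linordered_field, linorder_topology}) set" where
  "C_c X = {f. continuous_map X euclidean f \<and> countable (f ` topspace X)}"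

definition Z_c :: "'a topology \<Rightarrow> ('a \<Rightarrow> 'f::{linordered_field, linorder_topology}) \<Rightarrow> 'a set" where
  "Z_c X f = {x \<in> topspace X. f x = 0}"

text \<open>The field enters the next two notions through its type, hence the \<open>itself\<close> arguments.\<close>

definition Z_c_family ::
    "'a topology \<Rightarrow> 'f::{linordered_field, linorder_topology} itself \<Rightarrow> 'a set set" where
  "Z_c_family X F = Z_c X ` (C_c X :: ('a \<Rightarrow> 'f) set)"

definition CCFR_space ::
    "'a topology \<Rightarrow> 'f::{linordered_field, linorder_topology} itself \<Rightarrow> bool" where
  "CCFR_space X F \<longleftrightarrow>
     Hausdorff_space X \<and>
     (\<forall>K x. closedin X K \<and> x \<in> topspace X - K \<longrightarrow>
        (\<exists>f \<in> (C_c X :: ('a \<Rightarrow> 'f) set). f x = 0 \<and> (\<forall>y\<in>K. f y = 1)))"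

text \<open>
  Intersecting with \<open>topspace X\<close> makes the intersection of the empty subfamily the whole space
  rather than \<open>UNIV\<close>.
\<close>

definition closed_base_in :: "'a topology \<Rightarrow> 'a set set \<Rightarrow> bool" where
  "closed_base_in X \<B> \<longleftrightarrow>
     (\<forall>B\<in>\<B>. closedin X B) \<and>
     (\<forall>K. closedin X K \<longrightarrow> (\<exists>\<A>\<subseteq>\<B>. K = topspace X \<inter> \<Inter>\<A>))"

end

theory Submission
  imports Defs
begin

text \<open>
  All three conditions say that a point can be separated from a closed set not containing it: by a
  clopen set in (1), by a function that is \<open>0\<close> at the point and \<open>1\<close> on the closed set in (2), by a
  function that vanishes on the closed set but not at the point in (3). A clopen set yields the
  functions of (2) and (3) at once, because its two-valued indicators are continuous with finite
  range.

  The converse rests on the fact that a countable subset \<open>R\<close> of a dense linear order is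
  zero-dimensional in a strong sense: any \<open>u < v\<close> are separated by a cut whose two sides are
  open and cover \<open>R\<close> (\<open>countable_cut_between\<close>). If some \<open>c\<close> between \<open>u\<close> and \<open>v\<close>
  lies outside \<open>R\<close>, then the two open rays at \<open>c\<close> do it; but \<open>R\<close> may contain the whole
  interval, as for \<open>F = \<rat>\<close>. Cantor's nested intervals treat both cases together:
  shrinking intervals that avoid the points of \<open>R\<close> one after another leave each point of \<open>R\<close>
  strictly to the left or strictly to the right of some interval. Pulling such a cut back
  along a continuous function with countable range gives a clopen set separating two of its fibres
  (\<open>C_c_clopen_separation\<close>), whence (2) and (3) each imply (1).
\<close>

section \<open>Cuts avoiding a countable set\<close>

lemma subinterval_avoiding_point:
  fixes a b r :: "'f::dense_linorder"
  assumes "a < b"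
  obtains a' b' where "a \<le> a'" "a' < b'" "b' \<le> b" "r < a' \<or> b' < r"
proof -
  obtain c where c: "a < c" "c < b" using dense[OF assms] by blast
  show ?thesis
  proof (cases "r < c")
    case True
    then show ?thesis using that[of c b] c by simp
  next
    case False
    obtain d where "a < d" "d < c" using dense[OF c(1)] by blast
    moreover have "d < r" "d < b" using False \<open>d < c\<close> c by auto
    ultimately show ?thesis using that[of a d] by simp
  qed
qed

text \<open>
  The sides are the points left of some interval and the points right of some interval of a
  nested sequence whose \<open>n\<close>-th step avoids the \<open>n\<close>-th point of \<open>R\<close>. The intersection
  of the intervals, possibly empty, is what neither side covers, and it contains no point of \<open>R\<close>.
\<close>

lemma countable_cut_between:
  fixes u v :: "'f::{dense_linorder, linorder_topology}"
  assumes "countable R" and "u < v"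
  obtains U V where "open U" "open V" "U \<inter> V = {}" "R \<subseteq> U \<union> V" "u \<in> U" "v \<in> V"
proof -
  define r where "r = from_nat_into R"
  let ?P = "\<lambda>(n::nat) p. u < fst p \<and> fst p < snd p \<and> snd p < v"
  let ?Q = "\<lambda>n p p'. fst p \<le> fst p' \<and> snd p' \<le> snd p \<and> (r n < fst p' \<or> snd p' < r n)"
  have "\<exists>f. \<forall>n. ?P n (f n) \<and> ?Q n (f n) (f (Suc n))"
  proof (rule dependent_nat_choice)
    \<comment> \<open>The first interval lies strictly inside, so that its rays catch \<open>u\<close> and \<open>v\<close> themselves.\<close>
    obtain a where a: "u < a" "a < v" using dense[OF \<open>u < v\<close>] by blast
    obtain b where "a < b" "b < v" using dense[OF a(2)] by blast
    with a show "\<exists>p. ?P 0 p" by (intro exI[of _ "(a, b)"]) simp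
  next
    fix p n assume p: "?P n p"
    then have "fst p < snd p" by simp
    then obtain a b where "fst p \<le> a" "a < b" "b \<le> snd p" "r n < a \<or> b < r n"
      by (rule subinterval_avoiding_point)
    with p show "\<exists>p'. ?P (Suc n) p' \<and> ?Q n p p'" by (intro exI[of _ "(a, b)"]) auto
  qed
  then obtain f where P: "\<And>n. ?P n (f n)" and Q: "\<And>n. ?Q n (f n) (f (Suc n))" by blast
  define a b where "a = fst \<circ> f" and "b = snd \<circ> f"
  have "incseq a" "decseq b" using Q by (auto intro!: incseq_SucI decseq_SucI simp: a_def b_def)
  have a_less_b: "a m < b n" for m n
  proof -
    have "a m \<le> a (max m n)" using incseqD[OF \<open>incseq a\<close>] by simp
    also have "\<dots> < b (max m n)" using P by (simp add: a_def b_def)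
    also have "\<dots> \<le> b n" using decseqD[OF \<open>decseq b\<close>] by simp
    finally show ?thesis .
  qed
  show ?thesis
  proof (rule that[of "\<Union>n. {..<a n}" "\<Union>n. {b n<..}"])
    show "(\<Union>n. {..<a n}) \<inter> (\<Union>n. {b n<..}) = {}"
      using a_less_b by (force dest: less_trans)
    show "R \<subseteq> (\<Union>n. {..<a n}) \<union> (\<Union>n. {b n<..})"
    proof
      fix t assume "t \<in> R"
      then obtain n where "t = r n"
        using subset_range_from_nat_into[OF \<open>countable R\<close>] by (auto simp: r_def)
      then have "t < a (Suc n) \<or> b (Suc n) < t" using Q[of n] by (simp add: a_def b_def)
      then show "t \<in> (\<Union>n. {..<a n}) \<union> (\<Union>n. {b n<..})" by blast
    qed
    show "u \<in> (\<Union>n. {..<a n})" "v \<in> (\<Union>n. {b n<..})"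
      using P[of 0] by (auto simp: a_def b_def)
  qed auto
qed

section \<open>Clopen sets and functions with countable range\<close>

lemma zero_dimensional_space_clopen_separation:
  "zero_dimensional_space X \<longleftrightarrow>
     (\<forall>K x. closedin X K \<and> x \<in> topspace X - K \<longrightarrow>
        (\<exists>B. openin X B \<and> closedin X B \<and> x \<in> B \<and> B \<inter> K = {}))" (is "_ \<longleftrightarrow> ?sep")
proof
  assume "zero_dimensional_space X"
  then obtain \<B> where clopen: "\<forall>B\<in>\<B>. openin X B \<and> closedin X B"
    and base: "openin X = arbitrary union_of (\<lambda>B. B \<in> \<B>)"
    unfolding zero_dimensional_space_def by blast
  show ?sep
  proof (intro allI impI)
    fix K x assume "closedin X K \<and> x \<in> topspace X - K"
    then have "openin X (topspace X - K)" "x \<in> topspace X - K" by auto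
    then obtain B where "B \<in> \<B>" "x \<in> B" "B \<subseteq> topspace X - K"
      using base unfolding openin_topology_base_unique by blast
    with clopen show "\<exists>B. openin X B \<and> closedin X B \<and> x \<in> B \<and> B \<inter> K = {}" by blast
  qed
next
  assume sep: ?sep
  let ?\<B> = "{B. openin X B \<and> closedin X B}"
  have "\<exists>B\<in>?\<B>. x \<in> B \<and> B \<subseteq> U" if "openin X U" "x \<in> U" for U x
  proof -
    have "closedin X (topspace X - U)" "x \<in> topspace X - (topspace X - U)"
      using that openin_subset by auto
    with sep obtain B where "openin X B" "closedin X B" "x \<in> B" "B \<inter> (topspace X - U) = {}"
      by blast
    then show ?thesis using openin_subset by blast
  qed
  then have "openin X = arbitrary union_of (\<lambda>B. B \<in> ?\<B>)"
    unfolding openin_topology_base_unique by blast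
  then show "zero_dimensional_space X"
    unfolding zero_dimensional_space_def by (intro exI[of _ ?\<B>]) simp
qed

lemma clopen_indicator_in_C_c:
  assumes "openin X B" and "closedin X B"
  shows "(\<lambda>x. if x \<in> B then c else d) \<in> C_c X"
proof -
  let ?f = "\<lambda>x. if x \<in> B then c else d"
  have "openin X {x \<in> topspace X. ?f x \<in> U}" for U
  proof -
    have "openin X (topspace X - B)" using assms by blast
    moreover have "{x \<in> topspace X. ?f x \<in> U} =
        (if c \<in> U then B else {}) \<union> (if d \<in> U then topspace X - B else {})"
      using openin_subset[OF assms(1)] by auto
    ultimately show ?thesis using assms by auto
  qed
  moreover have "countable (?f ` topspace X)"
    by (rule countable_subset[of _ "{c, d}"]) auto
  ultimately show ?thesis by (simp add: C_c_def continuous_map_def)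
qed

text \<open>
  A cut of the range pulls back to a partition of the space into two open sets. In the conclusion
  \<open>a\<close> and \<open>b\<close> are interchangeable, since the complement of a clopen set is clopen; so \<open>a < b\<close>
  may be assumed.
\<close>

lemma C_c_clopen_separation:
  fixes f :: "'a \<Rightarrow> 'f::{linordered_field, linorder_topology}"
  assumes f: "f \<in> C_c X" and "a \<noteq> b"
  obtains B where "openin X B" "closedin X B"
    "{x \<in> topspace X. f x = a} \<subseteq> B" "B \<inter> {x \<in> topspace X. f x = b} = {}"
proof -
  have *: "\<exists>B. openin X B \<and> closedin X B \<and>
      {x \<in> topspace X. f x = u} \<subseteq> B \<and> B \<inter> {x \<in> topspace X. f x = v} = {}"
    if less: "u < v" for u v
  proof -
    have cont: "continuous_map X euclidean f" and cnt: "countable (f ` topspace X)"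
      using f by (auto simp: C_c_def)
    obtain U V where UV: "open U" "open V" "U \<inter> V = {}" "f ` topspace X \<subseteq> U \<union> V" "u \<in> U" "v \<in> V"
      using countable_cut_between[OF cnt less] .
    let ?B = "{x \<in> topspace X. f x \<in> U}" and ?C = "{x \<in> topspace X. f x \<in> V}"
    have "openin X ?B" "openin X ?C"
      using UV cont by (auto intro: openin_continuous_map_preimage)
    moreover have "topspace X - ?B = ?C" using UV by auto
    ultimately have "openin X ?B" "closedin X ?B" by (auto simp: closedin_def)
    then show ?thesis using UV by (intro exI[of _ ?B]) auto
  qed
  show ?thesis
  proof (cases "a < b")
    case True
    then show ?thesis using *[of a b] that by blast
  next
    case False
    with \<open>a \<noteq> b\<close> have "b < a" by simp
    from *[OF this] obtain B where B: "openin X B" "closedin X B"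
      "{x \<in> topspace X. f x = b} \<subseteq> B" "B \<inter> {x \<in> topspace X. f x = a} = {}" by blast
    show ?thesis by (rule that[of "topspace X - B"]) (use B in auto)
  qed
qed

lemma closedin_Z_c:
  assumes "f \<in> C_c X"
  shows "closedin X (Z_c X f)"
proof -
  have "closedin X {x \<in> topspace X. f x \<in> {0}}"
    using assms by (intro closedin_continuous_map_preimage[where Y = euclidean]) (auto simp: C_c_def)
  then show ?thesis by (simp add: Z_c_def)
qed

lemma closed_base_in_separation:
  "closed_base_in X \<B> \<longleftrightarrow> (\<forall>B\<in>\<B>. closedin X B) \<and>
     (\<forall>K x. closedin X K \<and> x \<in> topspace X - K \<longrightarrow> (\<exists>B\<in>\<B>. K \<subseteq> B \<and> x \<notin> B))"
  (is "_ \<longleftrightarrow> ?closed \<and> ?sep")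
proof
  assume base: "closed_base_in X \<B>"
  then have ?closed by (simp add: closed_base_in_def)
  moreover have ?sep
  proof (intro allI impI)
    fix K x assume K: "closedin X K \<and> x \<in> topspace X - K"
    with base obtain \<A> where "\<A> \<subseteq> \<B>" "K = topspace X \<inter> \<Inter>\<A>"
      unfolding closed_base_in_def by blast
    with K show "\<exists>B\<in>\<B>. K \<subseteq> B \<and> x \<notin> B" by blast
  qed
  ultimately show "?closed \<and> ?sep" ..
next
  assume sep: "?closed \<and> ?sep"
  have "K = topspace X \<inter> \<Inter>{B \<in> \<B>. K \<subseteq> B}" if "closedin X K" for K
    using that sep closedin_subset[OF that] by blast
  then show "closed_base_in X \<B>"
    unfolding closed_base_in_def using sep by (metis (no_types, lifting) mem_Collect_eq subsetI)
qed

section \<open>The equivalence\<close>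

theorem theorem2p9:
  fixes X :: "'a topology"
    and F :: "'f::{linordered_field, linorder_topology} itself"
  assumes "Hausdorff_space X"
  shows "(zero_dimensional_space X \<longleftrightarrow> CCFR_space X F) \<and>
         (CCFR_space X F \<longleftrightarrow> closed_base_in X (Z_c_family X F))"
proof -
  have "CCFR_space X F" if zd: "zero_dimensional_space X"
    unfolding CCFR_space_def
  proof (intro conjI allI impI)
    fix K x assume "closedin X K \<and> x \<in> topspace X - K"
    with zd obtain B where B: "openin X B" "closedin X B" "x \<in> B" "B \<inter> K = {}"
      unfolding zero_dimensional_space_clopen_separation by blast
    show "\<exists>f\<in>(C_c X :: ('a \<Rightarrow> 'f) set). f x = 0 \<and> (\<forall>y\<in>K. f y = 1)"
      by (rule bexI[OF _ clopen_indicator_in_C_c[OF B(1,2), of 0 1]]) (use B in auto)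
  qed fact
  moreover have "closed_base_in X (Z_c_family X F)" if zd: "zero_dimensional_space X"
    unfolding closed_base_in_separation
  proof (intro conjI allI impI)
    show "\<forall>Z\<in>Z_c_family X F. closedin X Z" by (auto simp: Z_c_family_def closedin_Z_c)
    fix K x assume K: "closedin X K \<and> x \<in> topspace X - K"
    with zd obtain B where B: "openin X B" "closedin X B" "x \<in> B" "B \<inter> K = {}"
      unfolding zero_dimensional_space_clopen_separation by blast
    let ?f = "\<lambda>y. if y \<in> B then 1 else 0 :: 'f"
    have "Z_c X ?f \<in> Z_c_family X F"
      unfolding Z_c_family_def by (intro imageI clopen_indicator_in_C_c B)
    moreover have "K \<subseteq> Z_c X ?f" "x \<notin> Z_c X ?f"
      using B K closedin_subset by (fastforce simp: Z_c_def)+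
    ultimately show "\<exists>Z\<in>Z_c_family X F. K \<subseteq> Z \<and> x \<notin> Z" by blast
  qed
  moreover have "zero_dimensional_space X" if ccfr: "CCFR_space X F"
    unfolding zero_dimensional_space_clopen_separation
  proof (intro allI impI)
    fix K x assume K: "closedin X K \<and> x \<in> topspace X - K"
    with ccfr obtain f :: "'a \<Rightarrow> 'f" where f: "f \<in> C_c X" "f x = 0" "\<forall>y\<in>K. f y = 1"
      unfolding CCFR_space_def by blast
    obtain B where "openin X B" "closedin X B"
      "{y \<in> topspace X. f y = 0} \<subseteq> B" "B \<inter> {y \<in> topspace X. f y = 1} = {}"
      using C_c_clopen_separation[OF f(1) zero_neq_one] .
    with f K show "\<exists>B. openin X B \<and> closedin X B \<and> x \<in> B \<and> B \<inter> K = {}"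
      using closedin_subset by (intro exI[of _ B]) blast
  qed
  moreover have "zero_dimensional_space X" if base: "closed_base_in X (Z_c_family X F)"
    unfolding zero_dimensional_space_clopen_separation
  proof (intro allI impI)
    fix K x assume K: "closedin X K \<and> x \<in> topspace X - K"
    with base obtain f :: "'a \<Rightarrow> 'f" where f: "f \<in> C_c X" "K \<subseteq> Z_c X f" "x \<notin> Z_c X f"
      unfolding closed_base_in_separation Z_c_family_def by blast
    then have "f x \<noteq> 0" using K by (simp add: Z_c_def)
    with f(1) obtain B where "openin X B" "closedin X B"
      "{y \<in> topspace X. f y = f x} \<subseteq> B" "B \<inter> {y \<in> topspace X. f y = 0} = {}"
      by (rule C_c_clopen_separation)
    with f K show "\<exists>B. openin X B \<and> closedin X B \<and> x \<in> B \<and> B \<inter> K = {}"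
      unfolding Z_c_def by (intro exI[of _ B]) blast
  qed
  ultimately show ?thesis by blast
qed

end
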